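(* Let $M$ be an existentially closed model of $T_3$. Then the lower central series of $M$ coincides with its upper central series in reverse order, i.e. $\gamma_i(M)=Z_{4-i}(M)$ for every $1\leq i\leq 3$. Moreover, $$\gamma_2(M)=\{[a,b]\mid a,b\in M\},\qquad \gamma_3(M)=\{[a,b,c]\mid a,b,c\in M\}.$$
   Context: $T_3$ is the first-order theory of groups (language $\{\cdot,{}^{-1},1\}$) satisfying $\forall x\,(x^3=1)$. A model $M$ of $T_3$ is existentially closed if for every finite tuple $\bar a$ in $M$, every extension $M\leq N$ with $N\models T_3$, and every quantifier-free formula $\varphi(\bar x,\bar y)$, $N\models\exists\bar x\,\varphi(\bar x,\bar a)$ implies $M\models\exists\bar x\,\varphi(\bar x,\bar a)$. Commutators: $[a,b]=aba^{-1}b^{-1}$ and $[a_1,\ldots,a_k]=[[a_1,\ldots,a_{k-1}],a_k]$. The lower central series of a group $G$ is $\gamma_1(G)=G$, $\gamma_{n+1}(G)=[\gamma_n(G),G]$ (the subgroup generated by the commutators). The upper central series is $Z_0(G)=1$ and $Z_n(G)=\{a\in G:[a,g_1,\ldots,g_n]=1\text{ for all }g_1,\ldots,g_n\in G\}$ for $n\geq1$. *)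

theory Defs
  imports "HOL-Algebra.Algebra"
begin

section \<open>Quantifier-free formulas in the language of groups\<close>

datatype gterm = Var nat | One | Inv gterm | Mul gterm gterm

datatype qform = Eq gterm gterm | Neg qform | And qform qform | Or qform qform

primrec tvars :: "gterm \<Rightarrow> nat set" where
  "tvars (Var i) = {i}"
| "tvars One = {}"
| "tvars (Inv t) = tvars t"
| "tvars (Mul s t) = tvars s \<union> tvars t"

primrec fvars :: "qform \<Rightarrow> nat set" where
  "fvars (Eq s t) = tvars s \<union> tvars t"
| "fvars (Neg \<phi>) = fvars \<phi>"
| "fvars (And \<phi> \<psi>) = fvars \<phi> \<union> fvars \<psi>"
| "fvars (Or \<phi> \<psi>) = fvars \<phi> \<union> fvars \<psi>"

text \<open>The variable \<open>Var i\<close> denotes the \<open>i\<close>-th entry of the list \<open>vs\<close>; the evaluation is only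
  meaningful when all variables are below \<open>length vs\<close>.\<close>

primrec teval :: "('a, 'm) monoid_scheme \<Rightarrow> 'a list \<Rightarrow> gterm \<Rightarrow> 'a" where
  "teval G vs (Var i) = vs ! i"
| "teval G vs One = \<one>\<^bsub>G\<^esub>"
| "teval G vs (Inv t) = inv\<^bsub>G\<^esub> (teval G vs t)"
| "teval G vs (Mul s t) = teval G vs s \<otimes>\<^bsub>G\<^esub> teval G vs t"

primrec holds :: "('a, 'm) monoid_scheme \<Rightarrow> 'a list \<Rightarrow> qform \<Rightarrow> bool" where
  "holds G vs (Eq s t) \<longleftrightarrow> teval G vs s = teval G vs t"
| "holds G vs (Neg \<phi>) \<longleftrightarrow> \<not> holds G vs \<phi>"
| "holds G vs (And \<phi> \<psi>) \<longleftrightarrow> holds G vs \<phi> \<and> holds G vs \<psi>"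
| "holds G vs (Or \<phi> \<psi>) \<longleftrightarrow> holds G vs \<phi> \<or> holds G vs \<psi>"

text \<open>\<open>G \<Turnstile> \<exists>x\<^sub>0 \<dots> x\<^sub>m\<^sub>-\<^sub>1. \<phi>(x, as)\<close>: the variables below \<open>m\<close> are quantified, the following
  \<open>length as\<close> variables stand for the parameters.\<close>

definition ex_holds :: "('a, 'm) monoid_scheme \<Rightarrow> nat \<Rightarrow> 'a list \<Rightarrow> qform \<Rightarrow> bool" where
  "ex_holds G m as \<phi> \<longleftrightarrow>
     (\<exists>xs. length xs = m \<and> set xs \<subseteq> carrier G \<and> holds G (xs @ as) \<phi>)"


section \<open>Existentially closed groups of exponent 3\<close>

definition T3_model :: "('a, 'm) monoid_scheme \<Rightarrow> bool" where
  "T3_model G \<longleftrightarrow> group G \<and> (\<forall>x \<in> carrier G. x [^]\<^bsub>G\<^esub> (3::nat) = \<one>\<^bsub>G\<^esub>)"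

text \<open>An extension \<open>M \<le> N\<close> is given by an embedding \<open>f \<in> mon M N\<close>. A definition in HOL cannot
  quantify over all types, so the extensions range over groups on the type \<open>'a + nat\<close>.
  This is no restriction, since it suffices to consider extensions generated by \<open>M\<close> together with
  a finite tuple; \<open>existentially_closedD\<close> below states the defining property for
  extensions over arbitrary types.\<close>

definition existentially_closed :: "('a, 'm) monoid_scheme \<Rightarrow> bool" where
  "existentially_closed M \<longleftrightarrow> T3_model M \<and>
     (\<forall>(N :: ('a + nat) monoid) f m as \<phi>.
        T3_model N \<longrightarrow> f \<in> mon M N \<longrightarrow> set as \<subseteq> carrier M \<longrightarrow>
        fvars \<phi> \<subseteq> {..<m + length as} \<longrightarrow>
        ex_holds N m (map f as) \<phi> \<longrightarrow> ex_holds M m as \<phi>)"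

lemma teval_mon:
  assumes "group A" "group B" "h \<in> hom A B" "set vs \<subseteq> carrier A" "tvars t \<subseteq> {..<length vs}"
  shows "teval A vs t \<in> carrier A \<and> teval B (map h vs) t = h (teval A vs t)"
proof -
  interpret group_hom A B h
    using assms by (simp add: group_hom_def group_hom_axioms_def)
  show ?thesis
    using assms(4,5) by (induction t) (auto dest: nth_mem)
qed

lemma holds_mon:
  assumes "group A" "group B" "h \<in> mon A B" "set vs \<subseteq> carrier A" "fvars \<phi> \<subseteq> {..<length vs}"
  shows "holds B (map h vs) \<phi> \<longleftrightarrow> holds A vs \<phi>"
proof -
  have h: "h \<in> hom A B" "inj_on h (carrier A)"
    using assms(3) by (auto simp: mon_def)
  show ?thesis
    using assms(5)
  proof (induction \<phi>)
    case (Eq s t)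
    then show ?case
      using teval_mon[OF assms(1,2) h(1) assms(4), of s] teval_mon[OF assms(1,2) h(1) assms(4), of t]
        h(2) by (auto simp: inj_on_def)
  qed auto
qed

lemma T3_model_mon:
  assumes "T3_model B" "group A" "h \<in> mon A B"
  shows "T3_model A"
proof -
  interpret group_hom A B h
    using assms by (simp add: group_hom_def group_hom_axioms_def T3_model_def mon_def)
  have "x [^]\<^bsub>A\<^esub> (3::nat) = \<one>\<^bsub>A\<^esub>" if x: "x \<in> carrier A" for x
  proof -
    have "h (x [^]\<^bsub>A\<^esub> (3::nat)) = h \<one>\<^bsub>A\<^esub>" "x [^]\<^bsub>A\<^esub> (3::nat) \<in> carrier A"
      using x assms by (simp_all add: hom_nat_pow T3_model_def G.nat_pow_closed)
    then show ?thesis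
      using x assms(3) unfolding mon_def by (blast dest: inj_onD intro: G.one_closed)
  qed
  then show ?thesis
    using assms(2) by (simp add: T3_model_def)
qed

lemma T3_generate_words:
  assumes N: "T3_model N" and S: "S \<subseteq> carrier N" "S \<subseteq> range s"
  shows "generate N S \<subseteq> range (\<lambda>us. foldr (\<lambda>u y. s u \<otimes>\<^bsub>N\<^esub> y) us \<one>\<^bsub>N\<^esub>)"
proof -
  interpret group N using N by (simp add: T3_model_def)
  let ?F = "\<lambda>us. foldr (\<lambda>u y. s u \<otimes>\<^bsub>N\<^esub> y) us \<one>\<^bsub>N\<^esub>"
  let ?U = "{us. s ` set us \<subseteq> carrier N}"
  have closed: "foldr (\<lambda>u y. s u \<otimes>\<^bsub>N\<^esub> y) us y \<in> carrier N" if "us \<in> ?U" "y \<in> carrier N" for us y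
    using that by (induction us) auto
  have app: "?F (us @ vs) = ?F us \<otimes>\<^bsub>N\<^esub> ?F vs" if "us \<in> ?U" "vs \<in> ?U" for us vs
    using that by (induction us) (auto simp: m_assoc closed)
  have "x \<in> ?F ` ?U" if "x \<in> generate N S" for x
    using that
  proof (induction rule: generate.induct)
    case one
    show ?case by (rule image_eqI[of _ _ "[]"]) auto
  next
    case (incl h)
    then obtain u where "h = s u" "h \<in> carrier N" using S by blast
    then show ?case by (intro image_eqI[of _ _ "[u]"]) auto
  next
    case (inv h)
    then obtain u where u: "h = s u" "h \<in> carrier N" using S by blast
    have "h \<otimes>\<^bsub>N\<^esub> h \<otimes>\<^bsub>N\<^esub> h = \<one>\<^bsub>N\<^esub>"
      using N u by (auto simp: T3_model_def numeral_3_eq_3)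
    then have "inv\<^bsub>N\<^esub> h = h \<otimes>\<^bsub>N\<^esub> h"
      using u by (metis inv_equality m_closed)
    then show ?case using u by (intro image_eqI[of _ _ "[u, u]"]) auto
  next
    case (eng h1 h2)
    then obtain us vs where "us \<in> ?U" "vs \<in> ?U" "h1 = ?F us" "h2 = ?F vs" by blast
    then show ?case using app by (intro image_eqI[of _ _ "us @ vs"]) auto
  qed
  then show ?thesis by blast
qed

theorem existentially_closedD:
  fixes M :: "('a, 'm) monoid_scheme" and N :: "('b, 'n) monoid_scheme"
  assumes ec: "existentially_closed M" and N: "T3_model N" and f: "f \<in> mon M N"
    and as: "set as \<subseteq> carrier M" and \<phi>: "fvars \<phi> \<subseteq> {..<m + length as}"
    and ex: "ex_holds N m (map f as) \<phi>"
  shows "ex_holds M m as \<phi>"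
proof -
  obtain xs where xs: "length xs = m" "set xs \<subseteq> carrier N" "holds N (xs @ map f as) \<phi>"
    using ex by (auto simp: ex_holds_def)
  interpret N: group N using N by (simp add: T3_model_def)
  have M: "group M" "T3_model M"
    using ec by (auto simp: existentially_closed_def T3_model_def)
  define S where "S = f ` carrier M \<union> set xs"
  have S: "S \<subseteq> carrier N"
    using f xs by (auto simp: S_def mon_def hom_def)
  define s :: "'a + nat \<Rightarrow> 'b" where "s = case_sum f (\<lambda>i. xs ! i)"
  have "S \<subseteq> range s"
  proof
    fix x assume "x \<in> S"
    then consider a where "x = f a" | i where "x = xs ! i"
      by (auto simp: S_def in_set_conv_nth)
    then show "x \<in> range s"
      by cases (auto simp: s_def intro: range_eqI[of _ _ "Inl _"] range_eqI[of _ _ "Inr _"])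
  qed
  from card_of_mono1[OF T3_generate_words[OF N S this]]
  have "|generate N S| \<le>o |UNIV :: ('a + nat) list set|"
    using card_of_image ordLeq_transitive by blast
  moreover have "|UNIV :: ('a + nat) list set| =o |UNIV :: ('a + nat) set|"
    using card_of_lists_infinite[of "UNIV :: ('a + nat) set"] by (simp add: finite_Plus_UNIV_iff)
  ultimately have "|generate N S| \<le>o |UNIV :: ('a + nat) set|"
    using ordLeq_ordIso_trans by blast
  then obtain e :: "'b \<Rightarrow> 'a + nat" where e: "inj_on e (generate N S)"
    by (auto simp flip: card_of_ordLeq)
  define K where "K = N\<lparr>carrier := generate N S\<rparr>"
  have sub: "subgroup (generate N S) N"
    using N.generate_is_subgroup[OF S] .
  have K: "group K"
    unfolding K_def using sub N.subgroup_imp_group by blast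
  have incl: "(\<lambda>x. x) \<in> mon K N"
    using N.generate_in_carrier[OF S] by (auto simp: K_def mon_def hom_def)
  define N' where "N' = image_group e K"
  have eK: "e \<in> mon K N'"
    using inj_imp_image_group_iso[of e K] e by (simp add: N'_def K_def iso_iff_mon_epi)
  have N': "group N'"
    using group.inj_imp_image_group_is_group[OF K] e by (simp add: N'_def K_def)
  have T3N': "T3_model N'"
  proof -
    have "inv_into (carrier K) e \<in> iso N' K"
      using inj_imp_image_group_iso[of e K] e group.iso_set_sym[OF K]
      by (simp add: N'_def K_def)
    then show ?thesis
      using T3_model_mon[OF T3_model_mon[OF N K incl] N'] iso_iff_mon_epi by blast
  qed
  have fK: "f \<in> mon M K"
    using f by (auto simp: K_def mon_def hom_def S_def intro: generate.incl)
  have vs: "set (xs @ map f as) \<subseteq> carrier K" "fvars \<phi> \<subseteq> {..<length (xs @ map f as)}"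
    using as \<phi> xs(1) by (auto simp: K_def S_def intro: generate.incl)
  have "holds K (xs @ map f as) \<phi>"
    using holds_mon[OF K _ incl vs] xs(3) N.is_group by simp
  then have "holds N' (map e (xs @ map f as)) \<phi>"
    using holds_mon[OF K N' eK vs] by blast
  moreover have "set (map e xs) \<subseteq> carrier N'"
    using vs(1) eK by (auto simp: mon_def hom_def)
  ultimately have "ex_holds N' m (map (e \<circ> f) as) \<phi>"
    using xs(1) by (auto simp: ex_holds_def intro!: exI[of _ "map e xs"])
  moreover have "e \<circ> f \<in> mon M N'"
    using mon_compose fK eK by blast
  ultimately show ?thesis
    using ec T3N' as \<phi> unfolding existentially_closed_def by blast
qed


section \<open>Commutators and central series\<close>

definition commutator :: "('a, 'm) monoid_scheme \<Rightarrow> 'a \<Rightarrow> 'a \<Rightarrow> 'a" where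
  "commutator G a b = a \<otimes>\<^bsub>G\<^esub> b \<otimes>\<^bsub>G\<^esub> inv\<^bsub>G\<^esub> a \<otimes>\<^bsub>G\<^esub> inv\<^bsub>G\<^esub> b"

text \<open>The left-normed commutator \<open>[a, g\<^sub>1, \<dots>, g\<^sub>n]\<close>, with the \<open>g\<^sub>i\<close> given as a list.\<close>

definition lcommutator :: "('a, 'm) monoid_scheme \<Rightarrow> 'a \<Rightarrow> 'a list \<Rightarrow> 'a" where
  "lcommutator G a gs = foldl (commutator G) a gs"

text \<open>The lower central series starts at index 1; the value at 0 is a dummy.\<close>

fun lower_central :: "('a, 'm) monoid_scheme \<Rightarrow> nat \<Rightarrow> 'a set" where
  "lower_central G 0 = carrier G"
| "lower_central G (Suc 0) = carrier G"
| "lower_central G (Suc (Suc n)) =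
     generate G {commutator G a b | a b. a \<in> lower_central G (Suc n) \<and> b \<in> carrier G}"

definition upper_central :: "('a, 'm) monoid_scheme \<Rightarrow> nat \<Rightarrow> 'a set" where
  "upper_central G n =
     {a \<in> carrier G. \<forall>gs. length gs = n \<longrightarrow> set gs \<subseteq> carrier G \<longrightarrow> lcommutator G a gs = \<one>\<^bsub>G\<^esub>}"

end

theory Submission
  imports Defs
begin

text \<open>In a group of exponent 3 the conjugates of an element commute, so \<open>[x, y, z]\<close> is
  alternating and \<open>[a, b, c, d] = 1\<close>; hence \<open>\<gamma>\<^sub>i \<subseteq> Z\<^sub>4\<^sub>-\<^sub>i\<close>. Conversely, every \<open>a \<in> Z\<^sub>2(M)\<close> is a
  commutator in some extension of exponent 3, obtained by adjoining two automorphisms of order 3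
  to \<open>M \<times> Z(M) \<times> Z(M)\<close>, and every \<open>a \<in> Z\<^sub>1(M)\<close> is \<open>[c, z]\<close> with \<open>c \<in> Z\<^sub>2(N)\<close> in some extension
  \<open>N\<close>, so that it becomes a threefold commutator. Existential closedness pulls these commutators
  back to \<open>M\<close>.\<close>

section \<open>Commutator calculus in groups of exponent 3\<close>

context group
begin

lemma cancel_inv_left [simp]:
  "x \<in> carrier G \<Longrightarrow> y \<in> carrier G \<Longrightarrow> x \<otimes> (inv x \<otimes> y) = y"
  "x \<in> carrier G \<Longrightarrow> y \<in> carrier G \<Longrightarrow> inv x \<otimes> (x \<otimes> y) = y"
  by (simp_all flip: m_assoc)

lemma commutator_closed [simp]:
  "x \<in> carrier G \<Longrightarrow> y \<in> carrier G \<Longrightarrow> commutator G x y \<in> carrier G"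
  by (simp add: commutator_def)

text \<open>Trades the commutator for products without inverses, which the explicit multiplication
  of the extensions built below can evaluate directly.\<close>

lemma commutator_eq_iff:
  assumes "x \<in> carrier G" "y \<in> carrier G" "c \<in> carrier G"
  shows "commutator G x y = c \<longleftrightarrow> x \<otimes> y = c \<otimes> (y \<otimes> x)"
proof -
  have "commutator G x y = (x \<otimes> y) \<otimes> inv (y \<otimes> x)"
    using assms by (simp add: commutator_def inv_mult_group m_assoc)
  then show ?thesis
    using assms by (metis inv_closed inv_solve_right' m_closed)
qed

lemma commutator_eq_one_iff:
  "x \<in> carrier G \<Longrightarrow> y \<in> carrier G \<Longrightarrow> commutator G x y = \<one> \<longleftrightarrow> x \<otimes> y = y \<otimes> x"
  by (simp add: commutator_eq_iff)

lemma inv_commutator: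
  "x \<in> carrier G \<Longrightarrow> y \<in> carrier G \<Longrightarrow> inv (commutator G x y) = commutator G y x"
  by (simp add: commutator_def inv_mult_group m_assoc)

lemma commutator_one_left [simp]: "x \<in> carrier G \<Longrightarrow> commutator G \<one> x = \<one>"
  by (simp add: commutator_eq_one_iff)

definition centralizer :: "'a set \<Rightarrow> 'a set" where
  "centralizer S = {v \<in> carrier G. \<forall>s\<in>S. v \<otimes> s = s \<otimes> v}"

lemma subgroup_centralizer:
  assumes "S \<subseteq> carrier G"
  shows "subgroup (centralizer S) G"
proof
  fix v w
  assume "v \<in> centralizer S" "w \<in> centralizer S"
  then have v: "v \<in> carrier G" "\<And>s. s \<in> S \<Longrightarrow> v \<otimes> s = s \<otimes> v"
    and w: "w \<in> carrier G" "\<And>s. s \<in> S \<Longrightarrow> w \<otimes> s = s \<otimes> w"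
    by (auto simp: centralizer_def)
  have "v \<otimes> w \<otimes> s = s \<otimes> (v \<otimes> w)" if "s \<in> S" for s
  proof -
    have s: "s \<in> carrier G" using that assms by auto
    have "v \<otimes> w \<otimes> s = v \<otimes> (s \<otimes> w)"
      using v(1) w(1) s by (simp add: m_assoc w(2)[OF that])
    also have "\<dots> = s \<otimes> (v \<otimes> w)"
      using v(1) w(1) s by (simp add: v(2)[OF that] flip: m_assoc)
    finally show ?thesis .
  qed
  then show "v \<otimes> w \<in> centralizer S"
    using v w by (simp add: centralizer_def)
  have "inv v \<otimes> s = s \<otimes> inv v" if "s \<in> S" for s
  proof -
    have s: "s \<in> carrier G" using that assms by auto
    have "inv v \<otimes> (s \<otimes> v) \<otimes> inv v = inv v \<otimes> (v \<otimes> s) \<otimes> inv v"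
      using that v by simp
    then show ?thesis using s v(1) by (simp add: m_assoc)
  qed
  then show "inv v \<in> centralizer S"
    using v by (simp add: centralizer_def)
qed (auto simp: centralizer_def subset_iff assms[THEN subsetD])

text \<open>\<open>g v g^-1\<close> commutes with s exactly when v commutes with
  \<open>g^-1 s g\<close>, which again lies in \<open>S\<close>.\<close>

lemma normal_centralizer:
  assumes S: "S \<subseteq> carrier G"
    and conj: "\<And>g s. g \<in> carrier G \<Longrightarrow> s \<in> S \<Longrightarrow> g \<otimes> s \<otimes> inv g \<in> S"
  shows "centralizer S \<lhd> G"
proof -
  have "g \<otimes> v \<otimes> inv g \<in> centralizer S" if g: "g \<in> carrier G" and v: "v \<in> centralizer S" for g v
  proof -
    have vG: "v \<in> carrier G" using v by (simp add: centralizer_def)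
    have "g \<otimes> v \<otimes> inv g \<otimes> s = s \<otimes> (g \<otimes> v \<otimes> inv g)" if s: "s \<in> S" for s
    proof -
      have sG: "s \<in> carrier G" using s S by auto
      have "v \<otimes> (inv g \<otimes> s \<otimes> g) = (inv g \<otimes> s \<otimes> g) \<otimes> v"
        using v conj[of "inv g" s] g s by (simp add: centralizer_def)
      then have "g \<otimes> (v \<otimes> (inv g \<otimes> s \<otimes> g)) \<otimes> inv g = g \<otimes> ((inv g \<otimes> s \<otimes> g) \<otimes> v) \<otimes> inv g"
        by simp
      then show ?thesis using g vG sG by (simp add: m_assoc)
    qed
    then show ?thesis using g vG by (simp add: centralizer_def)
  qed
  then show ?thesis
    using subgroup_centralizer[OF S] by (simp add: normal_inv_iff)
qed

end

text \<open>The cube is nested to the right, the form in which \<open>m_assoc\<close> leaves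
  products.\<close>

locale exp3_group = group +
  assumes cube: "x \<in> carrier G \<Longrightarrow> x \<otimes> (x \<otimes> x) = \<one>"

lemma T3_model_iff_exp3_group: "T3_model G \<longleftrightarrow> exp3_group G"
proof (cases "group G")
  case True
  then interpret group G .
  show ?thesis
    using True
    by (auto simp: T3_model_def exp3_group_def exp3_group_axioms_def numeral_3_eq_3 m_assoc)
qed (simp add: T3_model_def exp3_group_def)

section \<open>Exponent 3: commuting conjugates, alternating triple commutators, class at most
  3\<close>

context exp3_group
begin

lemma square_eq_inv: "x \<in> carrier G \<Longrightarrow> x \<otimes> x = inv x"
  using cube[of x] inv_equality[of "x \<otimes> x" x] by (simp add: m_assoc)

text \<open>\<open>(xy)^3 = 1\<close> reads \<open>(xyx)(yxy) = 1\<close>, so \<open>xyx\<close> is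
  the inverse of \<open>yxy\<close>.\<close>

lemma sandwich:
  assumes "x \<in> carrier G" "y \<in> carrier G"
  shows "x \<otimes> (y \<otimes> x) = inv y \<otimes> (inv x \<otimes> inv y)"
proof -
  have "(x \<otimes> (y \<otimes> x)) \<otimes> (y \<otimes> (x \<otimes> y)) = \<one>"
    using cube[of "x \<otimes> y"] assms by (simp add: m_assoc)
  then have "x \<otimes> (y \<otimes> x) = inv (y \<otimes> (x \<otimes> y))"
    using assms by (metis inv_equality m_closed)
  then show ?thesis
    using assms by (simp add: inv_mult_group m_assoc)
qed

text \<open>Both products equal \<open>x^-1 y^-1 x\<close>, by writing \<open>x^-1\<close> as
  \<open>x^2\<close> and applying \<open>sandwich\<close>.\<close>

lemma commute_conj:
  assumes x: "x \<in> carrier G" and y: "y \<in> carrier G"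
  shows "y \<otimes> (x \<otimes> y \<otimes> inv x) = (x \<otimes> y \<otimes> inv x) \<otimes> y"
proof -
  have "y \<otimes> (x \<otimes> y \<otimes> inv x) = y \<otimes> ((x \<otimes> (y \<otimes> x)) \<otimes> x)"
    using x y by (simp add: m_assoc flip: square_eq_inv)
  also have "\<dots> = inv x \<otimes> (inv y \<otimes> x)"
    using x y by (subst sandwich) (simp_all add: m_assoc)
  also have "\<dots> = x \<otimes> (x \<otimes> (inv y \<otimes> x))"
    using x y by (simp add: m_assoc flip: square_eq_inv[of x])
  also have "\<dots> = x \<otimes> (y \<otimes> (inv x \<otimes> y))"
    using x y by (simp add: sandwich[of x "inv y"])
  finally show ?thesis using x y by (simp add: m_assoc)
qed

text \<open>Conjugation by g reduces this to \<open>commute_conj\<close> with \<open>g^-1 h\<close>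
  as the conjugating element.\<close>

lemma commute_conjs:
  assumes "x \<in> carrier G" "g \<in> carrier G" "h \<in> carrier G"
  shows "(g \<otimes> x \<otimes> inv g) \<otimes> (h \<otimes> x \<otimes> inv h) = (h \<otimes> x \<otimes> inv h) \<otimes> (g \<otimes> x \<otimes> inv g)"
proof -
  let ?k = "inv g \<otimes> h"
  have "g \<otimes> (x \<otimes> (?k \<otimes> x \<otimes> inv ?k)) \<otimes> inv g = g \<otimes> ((?k \<otimes> x \<otimes> inv ?k) \<otimes> x) \<otimes> inv g"
    using assms by (subst commute_conj) simp_all
  then show ?thesis
    using assms by (simp add: m_assoc inv_mult_group)
qed

text \<open>With \<open>S\<close> the set of conjugates of \<open>x\<close>, \<open>S \<subseteq> C(S)\<close> gives \<open>C(C(S)) \<subseteq> C(S)\<close>; hence \<open>C(C(S))\<close>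
  is abelian.\<close>

lemma abelian_normal_subgroup_containing:
  assumes x: "x \<in> carrier G"
  obtains A where "A \<lhd> G" "x \<in> A" "\<And>u v. u \<in> A \<Longrightarrow> v \<in> A \<Longrightarrow> u \<otimes> v = v \<otimes> u"
proof -
  define S where "S = {g \<otimes> x \<otimes> inv g |g. g \<in> carrier G}"
  define C where "C = centralizer S"
  define A where "A = centralizer C"
  have S: "S \<subseteq> carrier G" using x by (auto simp: S_def)
  have "S \<subseteq> C"
    using S commute_conjs[OF x] by (fastforce simp: C_def centralizer_def S_def)
  then have AC: "A \<subseteq> C"
    by (auto simp: A_def C_def centralizer_def)
  have "g \<otimes> s \<otimes> inv g \<in> S" if "g \<in> carrier G" "s \<in> S" for g s
  proof -
    from that obtain h where h: "s = h \<otimes> x \<otimes> inv h" "h \<in> carrier G" by (auto simp: S_def)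
    then have "g \<otimes> s \<otimes> inv g = (g \<otimes> h) \<otimes> x \<otimes> inv (g \<otimes> h)"
      using that x by (simp add: m_assoc inv_mult_group)
    then show ?thesis using that h by (auto simp: S_def)
  qed
  then have C: "C \<lhd> G"
    unfolding C_def using S by (rule normal_centralizer[rotated])
  have "A \<lhd> G"
    unfolding A_def
  proof (rule normal_centralizer)
    show "C \<subseteq> carrier G" by (auto simp: C_def centralizer_def)
  qed (use C in \<open>simp add: normal.inv_op_closed2\<close>)
  moreover have "x \<in> S"
    using x by (auto simp: S_def intro!: exI[of _ \<one>])
  then have "x \<in> A"
    using x by (auto simp: A_def C_def centralizer_def)
  moreover have "u \<otimes> v = v \<otimes> u" if "u \<in> A" "v \<in> A" for u v
    using that AC by (auto simp: A_def centralizer_def)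
  ultimately show ?thesis by (rule that)
qed

text \<open>\<open>[x, y] = (x y x^-1) y^-1\<close> is a product of two elements that commute with
  y.\<close>

lemma engel2:
  assumes "x \<in> carrier G" "y \<in> carrier G"
  shows "commutator G (commutator G x y) y = \<one>"
proof -
  have "commutator G x y \<otimes> y = y \<otimes> commutator G x y"
  proof -
    have "commutator G x y \<otimes> y = x \<otimes> y \<otimes> inv x"
      using assms by (simp add: commutator_def m_assoc)
    also have "\<dots> = (x \<otimes> y \<otimes> inv x \<otimes> y) \<otimes> inv y"
      using assms by (simp add: m_assoc)
    also have "\<dots> = y \<otimes> commutator G x y"
      using assms by (simp flip: commute_conj) (simp add: commutator_def m_assoc)
    finally show ?thesis .
  qed
  then show ?thesis using assms by (simp add: commutator_eq_one_iff)
qed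

text \<open>Written additively, \<open>D\<^sub>y u = [u, y]\<close> is an endomorphism of \<open>A\<close> with \<open>D\<^sub>y\<^sup>2 = 0\<close> and
  \<open>D\<^sub>y\<^sub>z = D\<^sub>y + D\<^sub>z - D\<^sub>y D\<^sub>z\<close>. Multiplying \<open>D\<^sub>y\<^sub>z\<^sup>2 = 0\<close> by \<open>D\<^sub>y\<close> on the left gives
  \<open>D\<^sub>y D\<^sub>z D\<^sub>y = D\<^sub>y D\<^sub>z D\<^sub>y D\<^sub>z\<close>; multiplying this by \<open>D\<^sub>z\<close> on the right, both sides vanish, and
  \<open>D\<^sub>y\<^sub>z\<^sup>2 = 0\<close> is left with \<open>D\<^sub>y D\<^sub>z + D\<^sub>z D\<^sub>y = 0\<close>.\<close>

lemma commutator_swap_in_abelian_normal: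
  assumes A: "A \<lhd> G" and comm: "\<And>u v. u \<in> A \<Longrightarrow> v \<in> A \<Longrightarrow> u \<otimes> v = v \<otimes> u"
    and u: "u \<in> A" and y: "y \<in> carrier G" and z: "z \<in> carrier G"
  shows "commutator G (commutator G u z) y = inv (commutator G (commutator G u y) z)"
proof -
  interpret A: normal A G by (rule A)
  note [simp] = A.mem_carrier
  have lcomm: "v \<otimes> (w \<otimes> g) = w \<otimes> (v \<otimes> g)" if "v \<in> A" "w \<in> A" "g \<in> carrier G" for v w g
    using that comm[of v w] by (simp flip: m_assoc)
  have conj: "g \<otimes> (v \<otimes> inv g) \<in> A" if "g \<in> carrier G" "v \<in> A" for g v
    using A.inv_op_closed2[OF that] that by (simp add: m_assoc)
  have D_closed [simp]: "commutator G v g \<in> A" if "v \<in> A" "g \<in> carrier G" for v g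
    using A.m_closed[OF that(1) conj[of g "inv v"]] that by (simp add: commutator_def m_assoc)
  have D_mult: "commutator G (v \<otimes> w) g = commutator G v g \<otimes> commutator G w g"
    if "v \<in> A" "w \<in> A" "g \<in> carrier G" for v w g
  proof -
    define E where "E v = g \<otimes> (inv v \<otimes> inv g)" for v
    have E: "E v \<in> A" "E w \<in> A"
      using that conj by (simp_all add: E_def)
    have D: "commutator G v g = v \<otimes> E v" if "v \<in> A" for v
      using that \<open>g \<in> carrier G\<close> by (simp add: E_def commutator_def m_assoc)
    have "E (v \<otimes> w) = E w \<otimes> E v"
      using that by (simp add: E_def m_assoc inv_mult_group)
    then show ?thesis
      using that E by (simp add: D m_assoc lcomm[of "E v" w] comm[of "E v" "E w"])
  qed
  have D_inv: "commutator G (inv v) g = inv (commutator G v g)" if "v \<in> A" "g \<in> carrier G" for v g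
  proof -
    have "commutator G (inv v) g \<otimes> commutator G v g = \<one>"
      using D_mult[of "inv v" v g] that by simp
    then show ?thesis using that by (metis inv_equality commutator_closed A.mem_carrier inv_closed)
  qed
  have D_prod: "commutator G v (g \<otimes> h) =
      commutator G v g \<otimes> (commutator G v h \<otimes> inv (commutator G (commutator G v h) g))"
    if "v \<in> A" "g \<in> carrier G" "h \<in> carrier G" for v g h
  proof -
    let ?q = "commutator G v h"
    \<comment> \<open>Since \<open>[q, g]^-1 q = g q g^-1\<close>, the claim becomes
      \<open>[v, gh] = [v, g] (g [v, h] g^-1)\<close>, which holds in every group.\<close>
    have "commutator G v g \<otimes> (?q \<otimes> inv (commutator G ?q g)) =
        commutator G v g \<otimes> (inv (commutator G ?q g) \<otimes> ?q)"
      using that comm[of ?q "inv (commutator G ?q g)"] by simp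
    also have "\<dots> = commutator G v (g \<otimes> h)"
      using that by (simp add: commutator_def m_assoc inv_mult_group)
    finally show ?thesis ..
  qed
  define Y Z where "Y = (\<lambda>v. commutator G v y)" and "Z = (\<lambda>v. commutator G v z)"
  have [simp]: "Y v \<in> A" "Z v \<in> A" if "v \<in> A" for v
    using that y z by (simp_all add: Y_def Z_def)
  have [simp]: "Y (v \<otimes> w) = Y v \<otimes> Y w" "Z (v \<otimes> w) = Z v \<otimes> Z w" if "v \<in> A" "w \<in> A" for v w
    using that y z by (simp_all add: Y_def Z_def D_mult)
  have [simp]: "Y (inv v) = inv (Y v)" "Z (inv v) = inv (Z v)" "Y (Y v) = \<one>" "Z (Z v) = \<one>"
    if "v \<in> A" for v
    using that y z by (simp_all add: Y_def Z_def D_inv engel2)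
  have [simp]: "Y \<one> = \<one>" "Z \<one> = \<one>"
    using y z by (simp_all add: Y_def Z_def)
  \<comment> \<open>The nine terms of \<open>(Y + Z - YZ)^2\<close> without \<open>YY\<close>,
    \<open>ZZ\<close>, \<open>YYZ\<close> and \<open>YZZ\<close>, which vanish.\<close>
  have DD: "Z (Y v) \<otimes> (inv (Y (Z (Y v))) \<otimes>
      (Y (Z v) \<otimes> (inv (Z (Y (Z v))) \<otimes> Y (Z (Y (Z v)))))) = \<one>"
    if v: "v \<in> A" for v
  proof -
    have W: "commutator G w (y \<otimes> z) = Y w \<otimes> (Z w \<otimes> inv (Y (Z w)))" if "w \<in> A" for w
      using D_prod[OF that y z] by (simp add: Y_def Z_def)
    have "commutator G (commutator G v (y \<otimes> z)) (y \<otimes> z) = \<one>"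
      using v y z by (simp add: engel2)
    then show ?thesis
      using v by (simp add: W m_assoc inv_mult_group comm lcomm)
  qed
  have YZY: "Y (Z (Y v)) = Y (Z (Y (Z v)))" if v: "v \<in> A" for v
  proof -
    have "Y (Z (Y v)) \<otimes> inv (Y (Z (Y (Z v)))) = \<one>"
      using arg_cong[OF DD[OF v], of Y] v by simp
    then show ?thesis
      using v by (simp add: inv_solve_right')
  qed
  have YZY_one: "Y (Z (Y v)) = \<one>" if v: "v \<in> A" for v
    using YZY[OF v] YZY[of "Z v"] v by simp
  have "Z (Y (Z u)) = \<one>"
    using arg_cong[OF DD[OF u], of Z] u by (simp add: YZY_one)
  then have "Z (Y u) \<otimes> Y (Z u) = \<one>"
    using DD[OF u] u by (simp add: YZY_one)
  then have "Y (Z u) = inv (Z (Y u))"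
    using u comm[of "Z (Y u)"] by (simp add: inv_equality)
  then show ?thesis
    by (simp add: Y_def Z_def)
qed

text \<open>Every x lies in some abelian normal subgroup, and there
  \<open>commutator_swap_in_abelian_normal\<close> applies.\<close>

lemma commutator_swap_23:
  assumes "x \<in> carrier G" "y \<in> carrier G" "z \<in> carrier G"
  shows "commutator G (commutator G x z) y = inv (commutator G (commutator G x y) z)"
proof (rule abelian_normal_subgroup_containing[OF assms(1)])
  fix A
  assume "A \<lhd> G" "x \<in> A" "\<And>u v. u \<in> A \<Longrightarrow> v \<in> A \<Longrightarrow> u \<otimes> v = v \<otimes> u"
  then show ?thesis
    using assms by (intro commutator_swap_in_abelian_normal[of A]) auto
qed

text \<open>\<open>[x^-1, y] = x^-1 [y, x] x\<close>, and x commutes with \<open>[y, x]\<close> by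
  \<open>engel2\<close>.\<close>

lemma commutator_inv_left:
  assumes "x \<in> carrier G" "y \<in> carrier G"
  shows "commutator G (inv x) y = inv (commutator G x y)"
proof -
  have "commutator G (commutator G y x) x = \<one>"
    using assms by (simp add: engel2)
  then have "commutator G y x \<otimes> x = x \<otimes> commutator G y x"
    using assms by (simp add: commutator_eq_one_iff)
  then have "inv x \<otimes> (commutator G y x \<otimes> x) = inv x \<otimes> (x \<otimes> commutator G y x)"
    by simp
  then show ?thesis
    using assms by (simp add: inv_commutator) (simp add: commutator_def m_assoc)
qed

lemma commutator_swap_12:
  assumes "x \<in> carrier G" "y \<in> carrier G" "z \<in> carrier G"
  shows "commutator G (commutator G y x) z = inv (commutator G (commutator G x y) z)"
  using assms commutator_inv_left[of "commutator G x y" z] by (simp add: inv_commutator)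

lemma commutator_rotate:
  assumes "x \<in> carrier G" "y \<in> carrier G" "z \<in> carrier G"
  shows "commutator G (commutator G x y) z = commutator G (commutator G y z) x"
  using assms commutator_swap_23[of y x z] commutator_swap_12[of x y z] by simp

text \<open>By the alternating laws \<open>[a, b, c, d]\<close> is invariant under even permutations, in particular
  under \<open>(a, b, c, d) \<mapsto> (c, d, a, b)\<close>; but it also equals \<open>[[c, d], [a, b]]\<close>, which this
  permutation inverts.\<close>

lemma nilpotent_class_3:
  assumes G: "a \<in> carrier G" "b \<in> carrier G" "c \<in> carrier G" "d \<in> carrier G"
  shows "commutator G (commutator G (commutator G a b) c) d = \<one>"
proof -
  define f where "f a b c d = commutator G (commutator G (commutator G a b) c) d" for a b c d
  have f: "f a b c d = commutator G (commutator G c d) (commutator G a b)"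
    if "a \<in> carrier G" "b \<in> carrier G" "c \<in> carrier G" "d \<in> carrier G" for a b c d
    using that commutator_rotate[of "commutator G a b" c d] by (simp add: f_def)
  have f_closed: "f a b c d \<in> carrier G"
    using G by (simp add: f_def)
  have 34: "f a b d c = inv (f a b c d)"
    if "a \<in> carrier G" "b \<in> carrier G" "c \<in> carrier G" "d \<in> carrier G" for a b c d
    unfolding f_def by (rule commutator_swap_23) (use that in simp_all)
  have rot: "f a b c d = f b c a d"
    if "a \<in> carrier G" "b \<in> carrier G" "c \<in> carrier G" "d \<in> carrier G" for a b c d
    unfolding f_def using that by (subst commutator_rotate) simp_all
  have "f a b c d = inv (f a b d c)"
    by (rule 34) (use G in simp_all)
  also have "f a b d c = f d a b c"
    by (rule rot[symmetric]) (use G in simp_all)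
  also have "f d a b c = inv (f d a c b)"
    by (rule 34) (use G in simp_all)
  also have "f d a c b = f c d a b"
    by (rule rot[symmetric]) (use G in simp_all)
  also have "f c d a b = inv (f a b c d)"
    using G by (simp add: f inv_commutator)
  finally have "f a b c d = inv (f a b c d)"
    using f_closed by simp
  \<comment> \<open>An element whose square and cube are both 1 is trivial.\<close>
  then have "f a b c d \<otimes> f a b c d = \<one>"
    using r_inv[OF f_closed] by simp
  then show ?thesis
    using cube[OF f_closed] f_closed by (simp add: f_def)
qed

end


section \<open>Adjoining an automorphism of order 3\<close>

text \<open>The semidirect product of \<open>H\<close> with a cyclic group of order 3 whose
  generator x acts by \<open>\<sigma>\<close>; the pair \<open>(h, i)\<close> stands for
  \<open>h x^i\<close>.\<close>

definition cyc3_ext :: "('a, 'm) monoid_scheme \<Rightarrow> ('a \<Rightarrow> 'a) \<Rightarrow> ('a \<times> nat) monoid" where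
  "cyc3_ext H \<sigma> = \<lparr>carrier = carrier H \<times> {..<3},
     monoid.mult = (\<lambda>(h, i) (k, j). (h \<otimes>\<^bsub>H\<^esub> (\<sigma> ^^ i) k, (i + j) mod 3)), one = (\<one>\<^bsub>H\<^esub>, 0)\<rparr>"

lemma cyc3_ext_simps [simp]:
  "(h, i) \<in> carrier (cyc3_ext H \<sigma>) \<longleftrightarrow> h \<in> carrier H \<and> i < 3"
  "(h, i) \<otimes>\<^bsub>cyc3_ext H \<sigma>\<^esub> (k, j) = (h \<otimes>\<^bsub>H\<^esub> (\<sigma> ^^ i) k, (i + j) mod 3)"
  "\<one>\<^bsub>cyc3_ext H \<sigma>\<^esub> = (\<one>\<^bsub>H\<^esub>, 0)"
  by (simp_all add: cyc3_ext_def)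

text \<open>Writing \<open>x\<close> for the adjoined element, the last assumption says \<open>(h x)\<^sup>3 = 1\<close>.\<close>

locale cyc3_action = exp3_group H for H (structure) +
  fixes \<sigma>
  assumes hom: "\<sigma> \<in> hom H H"
    and norm: "h \<in> carrier H \<Longrightarrow> h \<otimes> (\<sigma> h \<otimes> \<sigma> (\<sigma> h)) = \<one>"
begin

sublocale \<sigma>: group_hom H H \<sigma>
  using hom by unfold_locales

text \<open>By \<open>norm\<close> at h and at \<open>\<sigma> h\<close>, the product of h,
  \<open>\<sigma> h\<close>, \<open>\<sigma>^2 h\<close>, \<open>\<sigma>^3 h\<close> collapses to
  \<open>\<sigma>^3 h\<close> from the left and to h from the right.\<close>

lemma order_3:
  assumes "h \<in> carrier H"
  shows "\<sigma> (\<sigma> (\<sigma> h)) = h"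
proof -
  have "\<sigma> (\<sigma> (\<sigma> h)) = h \<otimes> (\<sigma> h \<otimes> \<sigma> (\<sigma> h)) \<otimes> \<sigma> (\<sigma> (\<sigma> h))"
    using assms by (simp add: norm)
  also have "\<dots> = h \<otimes> (\<sigma> h \<otimes> (\<sigma> (\<sigma> h) \<otimes> \<sigma> (\<sigma> (\<sigma> h))))"
    using assms by (simp add: m_assoc)
  also have "\<dots> = h"
    using assms by (simp add: norm)
  finally show ?thesis .
qed

lemma funpow_hom: "(\<sigma> ^^ i) \<in> hom H H"
proof (induction i)
  case (Suc i)
  then show ?case by (auto simp: hom_def Pi_iff)
qed (simp add: hom_def)

lemma funpow_closed [simp]: "h \<in> carrier H \<Longrightarrow> (\<sigma> ^^ i) h \<in> carrier H"
  using funpow_hom by (auto simp: hom_def)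

lemma funpow_mult [simp]:
  "h \<in> carrier H \<Longrightarrow> k \<in> carrier H \<Longrightarrow> (\<sigma> ^^ i) (h \<otimes> k) = (\<sigma> ^^ i) h \<otimes> (\<sigma> ^^ i) k"
  using funpow_hom by (auto simp: hom_def)

lemma funpow_one [simp]: "(\<sigma> ^^ i) \<one> = \<one>"
  by (induction i) simp_all

lemma funpow_mod_3: "h \<in> carrier H \<Longrightarrow> (\<sigma> ^^ (i mod 3)) h = (\<sigma> ^^ i) h"
proof (induction i rule: less_induct)
  case (less i)
  show ?case
  proof (cases "i < 3")
    case False
    then obtain j where i: "i = 3 + j" by (metis le_add_diff_inverse not_less)
    then have "(\<sigma> ^^ i) h = (\<sigma> ^^ j) h"
      using less(2) order_3 by (simp add: numeral_3_eq_3)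
    then show ?thesis using less i by simp
  qed simp
qed

text \<open>The cube of \<open>(h, i)\<close> has first component
  \<open>h \<sigma>^i(h) \<sigma>^(2i)(h)\<close>. This is the cube of h for i = 0, the product in
  \<open>norm\<close> for i = 1, and reduces to \<open>norm\<close> by inversion for i = 2.\<close>

lemma exp3_group_cyc3_ext: "exp3_group (cyc3_ext H \<sigma>)"
proof -
  interpret K: group "cyc3_ext H \<sigma>"
  proof (rule groupI)
    fix p q r
    assume "p \<in> carrier (cyc3_ext H \<sigma>)" "q \<in> carrier (cyc3_ext H \<sigma>)" "r \<in> carrier (cyc3_ext H \<sigma>)"
    then show "p \<otimes>\<^bsub>cyc3_ext H \<sigma>\<^esub> q \<otimes>\<^bsub>cyc3_ext H \<sigma>\<^esub> r
        = p \<otimes>\<^bsub>cyc3_ext H \<sigma>\<^esub> (q \<otimes>\<^bsub>cyc3_ext H \<sigma>\<^esub> r)"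
      by (cases p; cases q; cases r)
        (simp add: m_assoc funpow_mod_3 funpow_add mod_simps add.assoc)
  next
    fix p
    assume "p \<in> carrier (cyc3_ext H \<sigma>)"
    then obtain h i where p: "p = (h, i)" "h \<in> carrier H" "i < 3" by (cases p) simp
    \<comment> \<open>The outer \<open>mod 3\<close> keeps the exponent of the inverse below 3 when
      i = 0.\<close>
    have "(\<sigma> ^^ ((3 - i) mod 3)) (inv h) \<otimes> (\<sigma> ^^ ((3 - i) mod 3)) h = \<one>"
      using p by (simp flip: funpow_mult)
    then show "\<exists>q\<in>carrier (cyc3_ext H \<sigma>). q \<otimes>\<^bsub>cyc3_ext H \<sigma>\<^esub> p = \<one>\<^bsub>cyc3_ext H \<sigma>\<^esub>"
      using p by (intro bexI[of _ "((\<sigma> ^^ ((3 - i) mod 3)) (inv h), (3 - i) mod 3)"])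
        (simp_all add: mod_simps)
  qed auto
  have "h \<otimes> ((\<sigma> ^^ i) h \<otimes> (\<sigma> ^^ i) ((\<sigma> ^^ i) h)) = \<one>" if "h \<in> carrier H" "i < 3" for h i
  proof -
    consider "i = 0" | "i = 1" | "i = 2" using \<open>i < 3\<close> by linarith
    then show ?thesis
    proof cases
      case 3
      \<comment> \<open>The factors now come in the order h, \<open>\<sigma>^2 h\<close>,
        \<open>\<sigma> h\<close>. Inverting \<open>norm\<close> at \<open>inv h\<close> reverses
        the product, and a cyclic rotation brings h to the front.\<close>
      have "inv h \<otimes> (\<sigma> (inv h) \<otimes> \<sigma> (\<sigma> (inv h))) = \<one>"
        using norm[of "inv h"] that by simp
      then have "inv (inv h \<otimes> (inv (\<sigma> h) \<otimes> inv (\<sigma> (\<sigma> h)))) = \<one>"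
        using that by simp
      then have "\<sigma> (\<sigma> h) \<otimes> \<sigma> h \<otimes> h = \<one>"
        using that by (simp add: inv_mult_group)
      then have "h \<otimes> (\<sigma> (\<sigma> h) \<otimes> \<sigma> h) = \<one>"
        using that inv_comm by simp
      then show ?thesis using that 3 by (simp add: numeral_2_eq_2 order_3)
    qed (use that in \<open>simp_all add: cube norm\<close>)
  qed
  moreover have "(i + (i + i)) mod 3 = 0" for i :: nat
    by presburger
  ultimately have "p \<otimes>\<^bsub>cyc3_ext H \<sigma>\<^esub> (p \<otimes>\<^bsub>cyc3_ext H \<sigma>\<^esub> p) = \<one>\<^bsub>cyc3_ext H \<sigma>\<^esub>"
    if "p \<in> carrier (cyc3_ext H \<sigma>)" for p
    using that by (cases p) (simp add: mod_simps)
  then show ?thesis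
    by unfold_locales
qed

lemma embed_cyc3_ext: "(\<lambda>h. (h, 0)) \<in> mon H (cyc3_ext H \<sigma>)"
  by (auto simp: mon_def hom_def inj_on_def)

text \<open>The adjoined x satisfies \<open>[x, h] = \<sigma>(h) h^-1\<close>. Prescribing a
  commutator thus amounts to prescribing a value of the automorphism.\<close>

lemma commutator_cyc3_ext:
  assumes h: "h \<in> carrier H" and c: "c \<in> carrier H" and eq: "\<sigma> h = c \<otimes> h"
  shows "commutator (cyc3_ext H \<sigma>) (\<one>, 1) (h, 0) = (c, 0)"
proof -
  interpret K: exp3_group "cyc3_ext H \<sigma>"
    by (rule exp3_group_cyc3_ext)
  show ?thesis
    using assms by (subst K.commutator_eq_iff) simp_all
qed

end


section \<open>The first two terms of the upper central series\<close>

context group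
begin

lemma upper_central_0: "upper_central G 0 = {\<one>}"
  by (auto simp: upper_central_def lcommutator_def)

text \<open>Taking the first entry off the list gives the usual recursion.\<close>

lemma upper_central_Suc:
  "upper_central G (Suc n) = {a \<in> carrier G. \<forall>g\<in>carrier G. commutator G a g \<in> upper_central G n}"
  unfolding upper_central_def
proof (intro Collect_cong conj_cong refl iffI ballI allI impI CollectI conjI)
  fix a gs
  assume a: "a \<in> carrier G"
    and *: "\<forall>g\<in>carrier G. commutator G a g \<in> {a \<in> carrier G. \<forall>gs. length gs = n \<longrightarrow>
      set gs \<subseteq> carrier G \<longrightarrow> lcommutator G a gs = \<one>}"
    and gs: "length gs = Suc n" "set gs \<subseteq> carrier G"
  from gs(1) obtain g hs where "gs = g # hs" by (cases gs) auto
  then show "lcommutator G a gs = \<one>"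
    using * gs by (simp add: lcommutator_def)
next
  fix a g gs
  assume *: "\<forall>gs. length gs = Suc n \<longrightarrow> set gs \<subseteq> carrier G \<longrightarrow> lcommutator G a gs = \<one>"
    and "g \<in> carrier G" "length gs = n" "set gs \<subseteq> carrier G"
  then have "lcommutator G a (g # gs) = \<one>"
    by (intro *[rule_format]) simp_all
  then show "lcommutator G (commutator G a g) gs = \<one>"
    by (simp add: lcommutator_def)
qed simp

abbreviation center :: "'a set" where
  "center \<equiv> centralizer (carrier G)"

lemma upper_central_1: "upper_central G 1 = center"
  by (auto simp: upper_central_Suc upper_central_0 centralizer_def commutator_eq_one_iff)

lemma upper_central_2:
  "upper_central G 2 = {a \<in> carrier G. \<forall>g\<in>carrier G. commutator G a g \<in> center}"
  using upper_central_Suc[of 1] upper_central_1 by (simp add: numeral_2_eq_2)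

lemma subgroup_center: "subgroup center G"
  by (simp add: subgroup_centralizer)

lemma center_in_carrier [simp]: "z \<in> center \<Longrightarrow> z \<in> carrier G"
  by (simp add: centralizer_def)

lemma center_closed [simp]:
  "z \<in> center \<Longrightarrow> w \<in> center \<Longrightarrow> z \<otimes> w \<in> center"
  "z \<in> center \<Longrightarrow> inv z \<in> center"
  "\<one> \<in> center"
  using subgroup_center
  by (simp_all add: subgroup.m_closed subgroup.m_inv_closed subgroup.one_closed)

lemma center_pow_closed [simp]: "z \<in> center \<Longrightarrow> z [^] (n::nat) \<in> center"
  by (induction n) simp_all

lemma center_commute: "z \<in> center \<Longrightarrow> g \<in> carrier G \<Longrightarrow> g \<otimes> z = z \<otimes> g"
  unfolding centralizer_def by (metis (mono_tags, lifting) mem_Collect_eq)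

lemma center_left_commute:
  "z \<in> center \<Longrightarrow> g \<in> carrier G \<Longrightarrow> h \<in> carrier G \<Longrightarrow> g \<otimes> (z \<otimes> h) = z \<otimes> (g \<otimes> h)"
  using m_assoc[of g z h] m_assoc[of z g h] center_commute[of z g] by simp

lemma center_ac:
  "z \<in> center \<Longrightarrow> w \<in> center \<Longrightarrow> z \<otimes> w = w \<otimes> z"
  "z \<in> center \<Longrightarrow> w \<in> center \<Longrightarrow> h \<in> carrier G \<Longrightarrow> z \<otimes> (w \<otimes> h) = w \<otimes> (z \<otimes> h)"
  by (rule center_commute, simp_all) (rule center_left_commute, simp_all)

text \<open>In any group \<open>[ab, g] = a [b, g] a^-1 [a, g]\<close>; centrality removes the
  conjugation and the order of the factors.\<close>

lemma commutator_mult_left_in_center: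
  assumes "commutator G a g \<in> center" "commutator G b g \<in> center"
    and "a \<in> carrier G" "b \<in> carrier G" "g \<in> carrier G"
  shows "commutator G (a \<otimes> b) g = commutator G a g \<otimes> commutator G b g"
proof -
  have "commutator G (a \<otimes> b) g = a \<otimes> (commutator G b g \<otimes> (g \<otimes> (inv a \<otimes> inv g)))"
    using assms(3-5) by (simp add: commutator_def m_assoc inv_mult_group)
  also have "\<dots> = commutator G b g \<otimes> commutator G a g"
    using assms center_left_commute[of "commutator G b g" a "g \<otimes> (inv a \<otimes> inv g)"]
    by (simp add: commutator_def[of G a] m_assoc)
  finally show ?thesis using assms by (simp add: center_ac)
qed

lemma commutator_mult_right_in_center:
  assumes "commutator G a g \<in> center" "commutator G a h \<in> center"
    and "a \<in> carrier G" "g \<in> carrier G" "h \<in> carrier G"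
  shows "commutator G a (g \<otimes> h) = commutator G a g \<otimes> commutator G a h"
proof -
  have "commutator G a (g \<otimes> h) = commutator G a g \<otimes> (g \<otimes> (commutator G a h \<otimes> inv g))"
    using assms(3-5) by (simp add: commutator_def m_assoc inv_mult_group)
  then show ?thesis
    using assms center_left_commute[of "commutator G a h" g "inv g"] by simp
qed

lemma subgroup_upper_central_2: "subgroup (upper_central G 2) G"
proof
  fix a
  assume a: "a \<in> upper_central G 2"
  have "commutator G (inv a) g \<in> center" if g: "g \<in> carrier G" for g
  proof -
    have "commutator G (inv a) g = inv a \<otimes> (inv (commutator G a g) \<otimes> a)"
      using a g by (simp add: upper_central_2 commutator_def m_assoc inv_mult_group)
    also have "\<dots> = inv (commutator G a g)"
      using a g center_left_commute[of "inv (commutator G a g)" "inv a" a]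
      by (simp add: upper_central_2)
    finally show ?thesis using a g by (simp add: upper_central_2)
  qed
  then show "inv a \<in> upper_central G 2"
    using a by (simp add: upper_central_2)
qed (auto simp: upper_central_2 commutator_mult_left_in_center)

end


section \<open>Extensions in which a given element becomes a commutator\<close>

context exp3_group
begin

lemma cube_left [simp]: "x \<in> carrier G \<Longrightarrow> h \<in> carrier G \<Longrightarrow> x \<otimes> (x \<otimes> (x \<otimes> h)) = h"
  using cube[of x] by (simp flip: m_assoc)

lemma pow_mod_3: "x \<in> carrier G \<Longrightarrow> x [^] (i mod 3) = x [^] (i::nat)"
proof -
  assume x: "x \<in> carrier G"
  have "x [^] (3::nat) = \<one>"
    using cube[OF x] x by (simp add: numeral_3_eq_3 m_assoc)
  then have "x [^] (3 * (i div 3)) = \<one>"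
    using x by (simp flip: nat_pow_pow)
  then show ?thesis
    using x nat_pow_mult[of x "3 * (i div 3)" "i mod 3"] by simp
qed

text \<open>First a direct factor of order 3 with generator c is adjoined, then an element z that
  centralizes \<open>G\<close> and conjugates c to \<open>a^-1 c\<close>. All commutators
  \<open>[c, g]\<close> are then powers of the central element a, and
  \<open>[c, z] = a\<close>.\<close>

lemma exists_extension_commutator_in_upper_central_2:
  assumes a: "a \<in> center"
  shows "\<exists>(N :: (('a \<times> nat) \<times> nat) monoid) f c z. exp3_group N \<and> f \<in> mon G N \<and>
    c \<in> upper_central N 2 \<and> z \<in> carrier N \<and> commutator N c z = f a"
proof -
  \<comment> \<open>The trivial action yields the direct product with a cyclic group of order
    3.\<close>
  interpret I: cyc3_action G id
    by unfold_locales (auto simp: hom_def cube)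
  define H where "H = cyc3_ext G id"
  interpret H: exp3_group H
    unfolding H_def by (rule I.exp3_group_cyc3_ext)
  \<comment> \<open>The inverse appears because \<open>commutator_cyc3_ext\<close> computes
    \<open>[z, c]\<close>, not \<open>[c, z]\<close>.\<close>
  define b where "b = inv a"
  have b: "b \<in> center" using a by (simp add: b_def)
  define \<sigma> where "\<sigma> = (\<lambda>(m, k). (b [^] k \<otimes> m, k :: nat))"
  interpret A: cyc3_action H \<sigma>
  proof
    have id_pow: "(id ^^ k) m = m" for k :: nat and m :: 'a
      by (induction k) simp_all
    have "b [^] ((k + l) mod 3) \<otimes> (m \<otimes> n) = b [^] k \<otimes> (m \<otimes> (b [^] l \<otimes> n))"
      if "m \<in> carrier G" "n \<in> carrier G" for m n and k l :: nat
      using that b center_left_commute[of "b [^] l" m n]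
      by (simp add: pow_mod_3 m_assoc flip: nat_pow_mult)
    then show "\<sigma> \<in> hom H H"
      using b by (auto simp: hom_def H_def \<sigma>_def id_pow m_assoc)
    have "m \<otimes> (B \<otimes> (m \<otimes> (B \<otimes> (B \<otimes> m)))) = \<one>" if "m \<in> carrier G" "B \<in> center" for m B
      using that center_left_commute[of B m] by (simp add: cube)
    moreover have "(k + (k + k)) mod 3 = 0" for k :: nat
      by presburger
    ultimately show "h \<otimes>\<^bsub>H\<^esub> (\<sigma> h \<otimes>\<^bsub>H\<^esub> \<sigma> (\<sigma> h)) = \<one>\<^bsub>H\<^esub>" if "h \<in> carrier H" for h
      using that b by (cases h) (simp add: H_def \<sigma>_def id_pow m_assoc mod_simps)
  qed
  define N where "N = cyc3_ext H \<sigma>"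
  interpret N: exp3_group N
    unfolding N_def by (rule A.exp3_group_cyc3_ext)
  define f where "f m = ((m, 0 :: nat), 0 :: nat)" for m :: 'a
  define c where "c = ((\<one>, 1 :: nat), 0 :: nat)"
  define z where "z = (\<one>\<^bsub>H\<^esub>, 1 :: nat)"
  have f: "f \<in> mon G N"
    using mon_compose[OF I.embed_cyc3_ext A.embed_cyc3_ext[unfolded H_def]]
    by (simp add: f_def[abs_def] comp_def N_def H_def)
  have \<sigma>_pow: "(\<sigma> ^^ i) (m, k) = ((b [^] k) [^] i \<otimes> m, k)" if "m \<in> carrier G" for m i k
    using that b by (induction i) (auto simp: \<sigma>_def m_assoc center_ac)
  have closed: "c \<in> carrier N" "z \<in> carrier N" "\<And>m. m \<in> carrier G \<Longrightarrow> f m \<in> carrier N"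
    by (simp_all add: c_def z_def f_def N_def H_def)
  have id_pow: "(id ^^ k) m = m" for k :: nat and m :: 'a
    by (induction k) simp_all
  \<comment> \<open>Both adjoined elements act trivially on the copy of \<open>G\<close>, so its
    center stays central.\<close>
  have f_center: "f d \<in> N.center" if d: "d \<in> center" for d
  proof -
    have "f d \<otimes>\<^bsub>N\<^esub> g = g \<otimes>\<^bsub>N\<^esub> f d" if "g \<in> carrier N" for g
      using that d b unfolding f_def N_def H_def
      by (cases g) (auto simp: \<sigma>_pow id_pow center_commute[OF d])
    then show ?thesis
      using closed(3)[OF center_in_carrier[OF d]] unfolding N.centralizer_def by blast
  qed
  have "commutator N c g \<in> N.center" if g: "g \<in> carrier N" for g
  proof -
    obtain m k i where mki: "g = ((m, k), i)" "m \<in> carrier G" "k < 3" "i < 3"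
      using g by (cases g) (auto simp: N_def H_def)
    \<comment> \<open>Moving c to the left past \<open>z^i\<close> costs a factor
      \<open>b^i\<close>, so \<open>[c, g] = b^-i\<close> depends only on the last exponent of
      g.\<close>
    have d: "inv b [^] i \<in> center"
      using b by simp
    have "inv b [^] i \<otimes> (m \<otimes> b [^] i) = m"
      using b mki(2) center_commute[of "b [^] i" m] by (simp add: nat_pow_inv flip: m_assoc)
    then have "c \<otimes>\<^bsub>N\<^esub> g = f (inv b [^] i) \<otimes>\<^bsub>N\<^esub> (g \<otimes>\<^bsub>N\<^esub> c)"
      using mki b by (simp add: f_def c_def N_def H_def \<sigma>_pow id_pow)
    then have "commutator N c g = f (inv b [^] i)"
      using closed g d by (simp add: N.commutator_eq_iff)
    then show ?thesis using f_center[OF d] by simp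
  qed
  then have c: "c \<in> upper_central N 2"
    using closed by (simp add: N.upper_central_2)
  have "commutator N z c = f b"
    using A.commutator_cyc3_ext[of "(\<one>, 1)" "(b, 0)"] b
    by (simp add: N_def H_def z_def c_def f_def \<sigma>_def)
  then have "commutator N c z = inv\<^bsub>N\<^esub> f b"
    using closed N.inv_commutator[of z c] by simp
  also have "\<dots> = f a"
  proof -
    interpret f: group_hom G N f
      using f by unfold_locales (simp add: mon_def)
    show ?thesis using a by (simp add: b_def flip: f.hom_inv)
  qed
  finally show ?thesis
    using N.exp3_group_axioms f c closed(2) by blast
qed

text \<open>In the extension \<open>\<langle>M, x, y\<rangle>\<close> with \<open>[y, x] = a\<close>, the element \<open>(((m, u, v), i), j)\<close> stands
  for \<open>m \<cdot> U(u) \<cdot> V(v) \<cdot> x\<^sup>i \<cdot> y\<^sup>j\<close>, where \<open>U\<close> and \<open>V\<close> are embeddings of the center with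
  \<open>[x, m] = U([a, m])\<close> and \<open>[y, m] = V([a, m])\<close>. The laws of exponent 3 force
  \<open>[x, V(v)] = v\<close> and \<open>[y, U(u)] = u\<^sup>2\<close>.\<close>

lemma exists_extension_commutator:
  assumes a: "a \<in> upper_central G 2"
  shows "\<exists>(N :: ((('a \<times> 'a \<times> 'a) \<times> nat) \<times> nat) monoid) f y x. exp3_group N \<and> f \<in> mon G N \<and>
    y \<in> carrier N \<and> x \<in> carrier N \<and> commutator N y x = f a"
proof -
  \<comment> \<open>As a lies in the second center, \<open>l\<close> is a homomorphism from
    \<open>G\<close> into the center; it governs both actions below.\<close>
  define l where "l = commutator G a"
  have aG [simp]: "a \<in> carrier G"
    using a by (simp add: upper_central_2)
  have l_center [simp]: "l m \<in> center" if "m \<in> carrier G" for m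
    using a that by (simp add: upper_central_2 l_def)
  have l_mult [simp]: "l (m \<otimes> n) = l m \<otimes> l n" if "m \<in> carrier G" "n \<in> carrier G" for m n
    using that l_center[unfolded l_def] by (simp add: l_def commutator_mult_right_in_center)
  have l_of_center [simp]: "l z = \<one>" if "z \<in> center" for z
    using that center_commute[of z a] by (simp add: l_def commutator_eq_one_iff)
  have l_pow_a [simp]: "l (a [^] i) = \<one>" for i :: nat
    using nat_pow_Suc2[of a i] by (simp add: l_def commutator_eq_one_iff)
  have a_pow: "a [^] i \<otimes> m = l m [^] i \<otimes> (m \<otimes> a [^] i)" if m: "m \<in> carrier G" for m and i :: nat
  proof (induction i)
    case (Suc i)
    have am: "a \<otimes> m = l m \<otimes> (m \<otimes> a)"
      using m commutator_eq_iff[of a m "l m"] by (simp add: l_def)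
    have "a [^] Suc i \<otimes> m = a [^] i \<otimes> (l m \<otimes> (m \<otimes> a))"
      using m by (simp add: m_assoc am)
    also have "\<dots> = l m \<otimes> ((a [^] i \<otimes> m) \<otimes> a)"
      using m center_left_commute[of "l m" "a [^] i" "m \<otimes> a"] by (simp add: m_assoc)
    also have "\<dots> = l m [^] Suc i \<otimes> (m \<otimes> a [^] Suc i)"
      using m by (simp add: Suc m_assoc center_ac)
    finally show ?case .
  qed (use m in simp)
  have a_pow_left: "a [^] i \<otimes> (m \<otimes> h) = l m [^] i \<otimes> (m \<otimes> (a [^] i \<otimes> h))"
    if "m \<in> carrier G" "h \<in> carrier G" for m h and i :: nat
    using a_pow[of m i] that by (simp add: m_assoc flip: m_assoc[of "a [^] i"])
  have pow_mult_center: "(z \<otimes> w) [^] i = z [^] i \<otimes> w [^] i"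
    if "z \<in> center" "w \<in> center" for z w and i :: nat
    using that by (intro pow_mult_distrib) (simp_all add: center_ac)
  define Z where "Z = G\<lparr>carrier := center\<rparr>"
  define H where "H = G \<times>\<times> Z \<times>\<times> Z"
  interpret Z: group Z
    unfolding Z_def using subgroup_center by (rule subgroup_imp_group)
  interpret ZZ: group "Z \<times>\<times> Z"
    by (rule DirProd_group) unfold_locales
  have "group H"
    unfolding H_def by (rule DirProd_group) unfold_locales
  then interpret H: exp3_group H
    by (intro exp3_group.intro exp3_group_axioms.intro)
      (auto simp: H_def Z_def cube)
  \<comment> \<open>Conjugation by x: \<open>U(u)\<close> is fixed, m gains the factor
    \<open>U([a, m])\<close> and \<open>V(v)\<close> gains v.\<close>
  define \<sigma> where "\<sigma> = (\<lambda>(m, u, v). (v \<otimes> m, u \<otimes> l m, v))"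
  interpret S: cyc3_action H \<sigma>
  proof
    show "\<sigma> \<in> hom H H"
      by (auto simp: hom_def H_def Z_def \<sigma>_def m_assoc center_ac
          intro: center_left_commute[symmetric])
    have "m \<otimes> (v \<otimes> (m \<otimes> (v \<otimes> (v \<otimes> m)))) = \<one>"
      if "m \<in> carrier G" "v \<in> center" for m v
      using that center_left_commute[of v m] by (simp add: cube)
    moreover have "u \<otimes> (u \<otimes> (w \<otimes> (u \<otimes> (w \<otimes> w)))) = \<one>"
      if "u \<in> center" "w \<in> center" for u w
      using that by (simp add: center_ac cube)
    ultimately show "h \<otimes>\<^bsub>H\<^esub> (\<sigma> h \<otimes>\<^bsub>H\<^esub> \<sigma> (\<sigma> h)) = \<one>\<^bsub>H\<^esub>" if "h \<in> carrier H" for h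
      using that by (cases h) (auto simp: H_def Z_def \<sigma>_def m_assoc cube)
  qed
  have \<sigma>_pow: "(\<sigma> ^^ i) (m, u, v) = (v [^] i \<otimes> m, u \<otimes> l m [^] i, v)"
    if "m \<in> carrier G" "u \<in> center" "v \<in> center" for m u v i
    using that by (induction i) (auto simp: \<sigma>_def m_assoc center_ac)
  define K where "K = cyc3_ext H \<sigma>"
  interpret K: exp3_group K
    unfolding K_def by (rule S.exp3_group_cyc3_ext)
  \<comment> \<open>Conjugation by y: m gains \<open>V([a, m])\<close>, \<open>U(u)\<close> gains
    \<open>u^2\<close>, and x becomes \<open>a x\<close>. Since a commutes with x by
    \<open>[a, a] = 1\<close>, \<open>x^i\<close> becomes \<open>a^i x^i\<close>.\<close>
  define \<tau> where "\<tau> = (\<lambda>((m, u, v), i :: nat). ((u \<otimes> (u \<otimes> (m \<otimes> a [^] i)), u, v \<otimes> l m), i))"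
  interpret T: cyc3_action K \<tau>
  proof
    show "\<tau> \<in> hom K K"
    proof (rule homI)
      fix p q
      assume "p \<in> carrier K" "q \<in> carrier K"
      then obtain m u v i n s t j where p: "p = ((m, u, v), i)" and q: "q = ((n, s, t), j)"
        and G: "m \<in> carrier G" "u \<in> center" "v \<in> center" "i < 3"
          "n \<in> carrier G" "s \<in> center" "t \<in> center" "j < 3"
        by (cases p, cases q) (auto simp: K_def H_def Z_def)
      note move = center_left_commute[of _ m] center_left_commute[of _ "a [^] i"]
        center_commute[of _ m] center_commute[of _ "a [^] i"]
        a_pow_left[OF \<open>n \<in> carrier G\<close>]
      \<comment> \<open>In the first component both sides carry \<open>l(n)^(2i)\<close>. On the
        left it is the square of the factor \<open>l(n)^i\<close> in the U-coordinate; on the right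
        one half comes from moving \<open>a^i\<close> past n, the other from \<open>x^i\<close>
        acting on \<open>V(l(n))\<close>.\<close>
      show "\<tau> (p \<otimes>\<^bsub>K\<^esub> q) = \<tau> p \<otimes>\<^bsub>K\<^esub> \<tau> q"
        using G unfolding p q
        by (simp add: K_def H_def Z_def \<tau>_def \<sigma>_pow m_assoc pow_mod_3 pow_mult_center move center_ac
            flip: nat_pow_mult)
    qed (auto simp: K_def H_def Z_def \<tau>_def)
    show "p \<otimes>\<^bsub>K\<^esub> (\<tau> p \<otimes>\<^bsub>K\<^esub> \<tau> (\<tau> p)) = \<one>\<^bsub>K\<^esub>" if pK: "p \<in> carrier K" for p
    proof -
      obtain m u v i where p: "p = ((m, u, v), i)"
        and G: "m \<in> carrier G" "u \<in> center" "v \<in> center" "i < 3"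
        using pK by (cases p) (auto simp: K_def H_def Z_def)
      note move = center_left_commute[of _ m] center_left_commute[of _ "a [^] i"]
        center_commute[of _ m] center_commute[of _ "a [^] i"]
        a_pow_left[OF \<open>m \<in> carrier G\<close>]
      have "(i + (i + i)) mod 3 = 0"
        by presburger
      then show ?thesis
        using G unfolding p
        by (simp add: K_def H_def Z_def \<tau>_def \<sigma>_pow m_assoc pow_mult_center move center_ac cube mod_simps)
    qed
  qed
  define N where "N = cyc3_ext K \<tau>"
  interpret N: exp3_group N
    unfolding N_def by (rule T.exp3_group_cyc3_ext)
  define f where "f m = (((m, \<one>, \<one>), 0 :: nat), 0 :: nat)" for m :: 'a
  define x where "x = (((\<one>, \<one>, \<one>), 1 :: nat), 0 :: nat)"
  define y where "y = (((\<one>, \<one>, \<one>), 0 :: nat), 1 :: nat)"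
  have "(\<lambda>m. (m, \<one>, \<one>)) \<in> mon G H"
    by (auto simp: mon_def hom_def inj_on_def H_def Z_def)
  from mon_compose[OF this mon_compose[OF S.embed_cyc3_ext T.embed_cyc3_ext[unfolded K_def]]]
  have "f \<in> mon G N"
    by (simp add: f_def[abs_def] comp_def N_def K_def)
  moreover have "commutator N y x = f a"
    using T.commutator_cyc3_ext[of "((\<one>, \<one>, \<one>), 1)" "((a, \<one>, \<one>), 0)"]
    by (simp add: N_def K_def H_def Z_def \<tau>_def x_def y_def f_def)
  moreover have "x \<in> carrier N" "y \<in> carrier N"
    by (simp_all add: N_def K_def H_def Z_def x_def y_def)
  ultimately show ?thesis
    using N.exp3_group_axioms by blast
qed

end

section \<open>Pulling the commutators back to an existentially closed group\<close>

theorem proposition4p12: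
  fixes M :: "('a, 'm) monoid_scheme"
  assumes "existentially_closed M"
  shows "(\<forall>i::nat. 1 \<le> i \<and> i \<le> 3 \<longrightarrow> lower_central M i = upper_central M (4 - i)) \<and>
    lower_central M 2 = {commutator M a b | a b. a \<in> carrier M \<and> b \<in> carrier M} \<and>
    lower_central M 3 =
      {lcommutator M a [b, c] | a b c. a \<in> carrier M \<and> b \<in> carrier M \<and> c \<in> carrier M}"
proof -
  have "exp3_group M"
    using assms by (simp add: existentially_closed_def T3_model_iff_exp3_group)
  then interpret M: exp3_group M .
  let ?C2 = "{commutator M a b | a b. a \<in> carrier M \<and> b \<in> carrier M}"
  let ?C3 = "{lcommutator M a [b, c] | a b c. a \<in> carrier M \<and> b \<in> carrier M \<and> c \<in> carrier M}"
  \<comment> \<open>The commutator as a term, to be evaluated in \<open>M\<close> and in its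
    extensions alike.\<close>
  define K where "K s t = Mul (Mul (Mul s t) (Inv s)) (Inv t)" for s t
  have K [simp]: "teval G vs (K s t) = commutator G (teval G vs s) (teval G vs t)"
    "tvars (K s t) = tvars s \<union> tvars t" for G :: "('c, 'n) monoid_scheme" and vs s t
    by (auto simp: K_def commutator_def)
  have U2: "upper_central M 2 \<subseteq> ?C2"
  proof
    fix a
    assume a: "a \<in> upper_central M 2"
    obtain N :: "((('a \<times> 'a \<times> 'a) \<times> nat) \<times> nat) monoid" and f y x
      where N: "exp3_group N" "f \<in> mon M N" "y \<in> carrier N" "x \<in> carrier N" "commutator N y x = f a"
      using M.exists_extension_commutator[OF a] by blast
    let ?\<phi> = "Eq (K (Var 0) (Var 1)) (Var 2)"
    have "ex_holds N 2 (map f [a]) ?\<phi>"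
      using N unfolding ex_holds_def by (intro exI[of _ "[y, x]"]) simp
    then have "ex_holds M 2 [a] ?\<phi>"
      using a N by (intro existentially_closedD[OF assms, of N f])
        (auto simp: T3_model_iff_exp3_group M.upper_central_2)
    then show "a \<in> ?C2"
      by (auto simp: ex_holds_def length_Suc_conv numeral_2_eq_2) blast
  qed
  have U1: "upper_central M 1 \<subseteq> ?C3"
  proof
    fix a
    assume "a \<in> upper_central M 1"
    then have a: "a \<in> M.center"
      by (simp only: M.upper_central_1)
    obtain N :: "(('a \<times> nat) \<times> nat) monoid" and f c z
      where N: "exp3_group N" "f \<in> mon M N" "c \<in> upper_central N 2" "z \<in> carrier N"
        "commutator N c z = f a"
      using M.exists_extension_commutator_in_upper_central_2[OF a] by blast
    interpret N: exp3_group N by (rule N(1))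
    \<comment> \<open>As c lies in the second center of \<open>N\<close>, it becomes a commutator
      \<open>[y, x]\<close> in a further extension, where the image of a is
      \<open>[y, x, g z]\<close>.\<close>
    obtain P :: "((((('a \<times> nat) \<times> nat) \<times> (('a \<times> nat) \<times> nat) \<times> (('a \<times> nat) \<times> nat)) \<times> nat) \<times> nat) monoid"
      and g y x
      where P: "exp3_group P" "g \<in> mon N P" "y \<in> carrier P" "x \<in> carrier P" "commutator P y x = g c"
      using N.exists_extension_commutator[OF N(3)] by blast
    let ?\<phi> = "Eq (K (K (Var 0) (Var 1)) (Var 2)) (Var 3)"
    interpret P: exp3_group P by (rule P(1))
    interpret g: group_hom N P g
      using P by unfold_locales (simp add: mon_def)
    have "commutator P (g c) (g z) = g (f a)"
      using N(3,4,5) by (simp add: commutator_def N.upper_central_2 flip: g.hom_inv g.hom_mult)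
    then have "ex_holds P 3 (map (g \<circ> f) [a]) ?\<phi>"
      using P N(4) unfolding ex_holds_def by (intro exI[of _ "[y, x, g z]"]) simp
    moreover have "g \<circ> f \<in> mon M P"
      using N(2) P(2) by (rule mon_compose)
    ultimately have "ex_holds M 3 [a] ?\<phi>"
      using a P(1) by (intro existentially_closedD[OF assms, of P "g \<circ> f"])
        (auto simp: T3_model_iff_exp3_group)
    then obtain xs where xs: "length xs = 3" "set xs \<subseteq> carrier M" "holds M (xs @ [a]) ?\<phi>"
      by (auto simp: ex_holds_def)
    then obtain p q r where "xs = [p, q, r]"
      by (auto simp: length_Suc_conv numeral_3_eq_3)
    then show "a \<in> ?C3"
      using xs by (auto simp: lcommutator_def)
  qed
  have "lower_central M 2 \<subseteq> upper_central M 2"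
  proof -
    have "c \<in> M.center" if "c \<in> carrier M" "\<And>d. d \<in> carrier M \<Longrightarrow> commutator M c d = \<one>\<^bsub>M\<^esub>" for c
      using that M.commutator_eq_one_iff unfolding M.centralizer_def by blast
    then have "?C2 \<subseteq> upper_central M 2"
      by (auto simp: M.upper_central_2 M.nilpotent_class_3)
    then have "generate M ?C2 \<subseteq> upper_central M 2"
      using M.subgroup_upper_central_2 by (rule M.generate_subgroup_incl)
    then show ?thesis by (simp add: numeral_2_eq_2)
  qed
  moreover have "?C2 \<subseteq> lower_central M 2"
    by (auto simp: numeral_2_eq_2 intro: generate.incl)
  \<comment> \<open>The inclusions close up into a cycle: \<open>\<gamma>\<^sub>2\<close> lies in
    \<open>Z\<^sub>2\<close>, this in the set of commutators, and that in
    \<open>\<gamma>\<^sub>2\<close>.\<close>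
  ultimately have L2: "lower_central M 2 = upper_central M 2" "lower_central M 2 = ?C2"
    using U2 by auto
  have L3_eq: "lower_central M 3 = generate M {commutator M a b | a b. a \<in> lower_central M 2 \<and> b \<in> carrier M}"
    by (simp add: numeral_3_eq_3 numeral_2_eq_2)
  have "lower_central M 3 \<subseteq> upper_central M 1"
    unfolding L3_eq M.upper_central_1
    using M.subgroup_center
    by (intro M.generate_subgroup_incl) (auto simp: L2(1) M.upper_central_2)
  \<comment> \<open>Because \<open>\<gamma>\<^sub>2\<close> consists of commutators, each
    \<open>[a, b, c]\<close> is one of the generators of \<open>\<gamma>\<^sub>3\<close>.\<close>
  moreover have "?C3 \<subseteq> lower_central M 3"
    unfolding L3_eq L2(2) by (auto simp: lcommutator_def intro!: generate.incl)
  ultimately have L3: "lower_central M 3 = upper_central M 1" "lower_central M 3 = ?C3"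
    using U1 by auto
  \<comment> \<open>Class at most 3 means that \<open>Z\<^sub>3\<close> is the whole group.\<close>
  have "lower_central M 1 = upper_central M 3"
    by (auto simp: upper_central_def lcommutator_def length_Suc_conv numeral_3_eq_3
        M.nilpotent_class_3)
  then have "lower_central M i = upper_central M (4 - i)" if "1 \<le> i" "i \<le> 3" for i
  proof -
    consider "i = 1" | "i = 2" | "i = 3" using \<open>1 \<le> i\<close> \<open>i \<le> 3\<close> by linarith
    then show ?thesis
      using \<open>lower_central M 1 = _\<close> L2 L3 by cases simp_all
  qed
  then show ?thesis using L2 L3 by blast
qed

end
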